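(* Let $X$ be a real Hilbert space, let $m\in\{2,3,\dots\}$, and let $A_1,\dots,A_m: X\rightrightarrows X$ be maximally monotone operators with resolvents $J_1,\dots,J_m$. For all $i,j\in\{1,\dots,m\}$ the following hold. (1) $F_i$ is closed and convex. Moreover, for $j\neq i$, $F_i=(J_iJ_{i-1}\cdots J_{j+1})(F_j)$, where indices are read cyclically modulo $m$ in $\{1,\dots,m\}$ (the composition starts with $J_{j+1}$ and applies the successive resolvents in cyclic order, ending with $J_i$). For instance $F_m=(J_mJ_{m-1}\cdots J_2)(F_1)=(J_mJ_{m-1}\cdots J_3)(F_2)=\cdots=J_m(F_{m-1})$ and $F_1=(J_1J_m\cdots J_3)(F_2)=\cdots=(J_1J_m)(F_{m-1})=J_1(F_m)$. (2) $\bigcap_{i=1}^m\operatorname{Fix}J_i\subseteq\bigcap_{i=1}^mF_i$, and if $F_i=\varnothing$, then $\bigcap_{i=1}^m\operatorname{Fix}J_i=\varnothing$. (3) For $1\le i\le m-1$, $J_{i+1}(F_i)=F_{i+1}$, and $J_1(F_m)=F_1$. Therefore $\mathbf J_{\mathbf A}\mathbf R(F_1\times F_2\times\cdots\times F_m)=F_1\times F_2\times\cdots\times F_m$. (4) $F_i\neq\varnothing$ if and only if $F_j\neq\varnothing$ if and only if $\mathbf Z\neq\varnothing$. (5) $\mathbf Z$ is closed and convex, and $\mathbf Z\subseteq F_1\times F_2\times\cdots\times F_m$. (6) The mapping $Q_i|_{\mathbf Z}:\mathbf Z\to F_i$ is bijective and $Q_i(\mathbf Z)=F_i$.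
   Context: $\mathbf X=X^m$ is the Hilbert product space. $J_i=(\mathrm{Id}+A_i)^{-1}$ is the resolvent of $A_i$. $\operatorname{Fix}S=\{x\mid x=Sx\}$. For $i\in\{1,\dots,m\}$, $F_i:=\operatorname{Fix}(J_iJ_{i-1}\cdots J_1J_m\cdots J_{i+1})$ (so $F_1=\operatorname{Fix}(J_1J_m\cdots J_2)$, ..., $F_m=\operatorname{Fix}(J_mJ_{m-1}\cdots J_1)$). $\mathbf A=A_1\times\cdots\times A_m$, with resolvent $\mathbf J_{\mathbf A}:\mathbf X\to\mathbf X:(x_1,\dots,x_m)\mapsto(J_1x_1,\dots,J_mx_m)$. $\mathbf R:\mathbf X\to\mathbf X:(x_1,\dots,x_m)\mapsto(x_m,x_1,\dots,x_{m-1})$ is the circular right-shift operator. The set of all cycles is $\mathbf Z:=\operatorname{Fix}(\mathbf J_{\mathbf A}\mathbf R)$. $Q_i:\mathbf X\to X:\mathbf z=(z_1,\dots,z_m)\mapsto z_i$. *)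

theory Defs
  imports "HOL-Analysis.Analysis"
begin

type_synonym 'a operator = "'a \<Rightarrow> 'a set"

definition monotone_operator :: "'a::real_inner operator \<Rightarrow> bool" where
  "monotone_operator A \<longleftrightarrow>
    (\<forall>x y. \<forall>u\<in>A x. \<forall>v\<in>A y. 0 \<le> (x - y) \<bullet> (u - v))"

definition maximally_monotone :: "'a::real_inner operator \<Rightarrow> bool" where
  "maximally_monotone A \<longleftrightarrow>
    monotone_operator A \<and>
    (\<forall>B. monotone_operator B \<and> (\<forall>x. A x \<subseteq> B x) \<longrightarrow> B = A)"

definition Id_plus :: "'a::real_vector operator \<Rightarrow> 'a operator" where
  "Id_plus A x = {x + u |u. u \<in> A x}"

definition inverse_operator :: "'a operator \<Rightarrow> 'a operator" where
  "inverse_operator A y = {x. y \<in> A x}"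

text \<open>For maximally monotone operators on a Hilbert space the inverse of Id + A is
  single-valued with full domain (Minty), so that the description operator picks its
  only value.\<close>

definition resolvent :: "'a::real_vector operator \<Rightarrow> 'a \<Rightarrow> 'a" where
  "resolvent A y = (THE x. x \<in> inverse_operator (Id_plus A) y)"

definition Fix :: "('a \<Rightarrow> 'a) \<Rightarrow> 'a set" where
  "Fix S = {x. x = S x}"

text \<open>The indices j+1, ..., i read cyclically in 1, ..., m; for j = i this is one full
  cycle i+1, ..., m, 1, ..., i. The leftmost index of the list is applied first:
  \<open>fold J [k\<^sub>1, \<dots>, k\<^sub>n] = J k\<^sub>n \<circ> \<dots> \<circ> J k\<^sub>1\<close>.\<close>

definition cyclic_indices :: "nat \<Rightarrow> nat \<Rightarrow> nat \<Rightarrow> nat list" where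
  "cyclic_indices m j i =
    (if j < i then [j+1..<i+1] else [j+1..<m+1] @ [1..<i+1])"

definition cyclic_comp :: "nat \<Rightarrow> (nat \<Rightarrow> 'a \<Rightarrow> 'a) \<Rightarrow> nat \<Rightarrow> nat \<Rightarrow> 'a \<Rightarrow> 'a" where
  "cyclic_comp m J j i = fold J (cyclic_indices m j i)"

definition cyclic_Fix :: "nat \<Rightarrow> (nat \<Rightarrow> 'a \<Rightarrow> 'a) \<Rightarrow> nat \<Rightarrow> 'a set" where
  "cyclic_Fix m J i = Fix (cyclic_comp m J i i)"

text \<open>The Hilbert product space X^m is the library type \<open>'a ^ 'n\<close>. To number its
  components by 1, ..., m, the definitions below take an enumeration \<open>e\<close> with
  \<open>bij_betw e {1..m} UNIV\<close>, which in particular forces \<open>CARD('n) = m\<close>.\<close>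

definition component :: "(nat \<Rightarrow> 'n::finite) \<Rightarrow> nat \<Rightarrow> 'a ^ 'n \<Rightarrow> 'a" where
  "component e i x = x $ e i"

definition tuple :: "nat \<Rightarrow> (nat \<Rightarrow> 'n::finite) \<Rightarrow> (nat \<Rightarrow> 'a) \<Rightarrow> 'a ^ 'n" where
  "tuple m e f = (\<chi> k. f (the_inv_into {1..m} e k))"

definition product_set :: "nat \<Rightarrow> (nat \<Rightarrow> 'n::finite) \<Rightarrow> (nat \<Rightarrow> 'a set) \<Rightarrow> ('a ^ 'n) set" where
  "product_set m e C = {x. \<forall>i\<in>{1..m}. component e i x \<in> C i}"

definition product_operator ::
    "nat \<Rightarrow> (nat \<Rightarrow> 'n::finite) \<Rightarrow> (nat \<Rightarrow> 'a operator) \<Rightarrow> ('a ^ 'n) operator" where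
  "product_operator m e A x = product_set m e (\<lambda>i. A i (component e i x))"

definition right_shift :: "nat \<Rightarrow> (nat \<Rightarrow> 'n::finite) \<Rightarrow> 'a ^ 'n \<Rightarrow> 'a ^ 'n" where
  "right_shift m e x =
    tuple m e (\<lambda>i. if i = 1 then component e m x else component e (i - 1) x)"

end

theory Submission
  imports Defs
begin

text \<open>Everything rests on three ideas.

Minty's theorem makes the resolvents total. A resolvent is introduced by a definite description,
so nothing can be said about it before \<open>Id + A\<close> is known to be surjective. Surjectivity is
obtained from the Fitzpatrick function \<open>(x, u) \<mapsto> sup {x \<bullet> b + a \<bullet> u - a \<bullet> b | b \<in> A a}\<close>: it is
convex and lower semicontinuous, it dominates the duality product \<open>x \<bullet> u\<close>, and on the graph of
\<open>A\<close> it equals that product. Adding half the squared norm gives a strongly convex function, whose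
minimiser exists by completeness (\<open>strongly_convex_minimizer\<close>). The first-order condition at
the minimiser \<open>(x, u)\<close>, read along the graph of \<open>A\<close>, says that \<open>(- u, - x)\<close> is monotonically
related to the graph; maximality puts it on the graph, and the same inequality then gives
\<open>u = - x\<close>, so \<open>0 \<in> x + A x\<close>. Monotonicity makes the resolvents nonexpansive.

In an inner product space the fixed points of a nonexpansive mapping form a closed convex set.
The compositions defining the \<open>F\<^sub>i\<close> are nonexpansive, and so is the product of the resolvents
preceded by the shift, which is an isometry. Hence every \<open>F\<^sub>i\<close> and \<open>Z\<close> are closed and convex.

All remaining claims are combinatorial and hold for arbitrary mappings \<open>J\<^sub>1, \<dots>, J\<^sub>m\<close>. A fixed point
of the shifted product is a family \<open>z\<close> with \<open>z\<^sub>i = J\<^sub>i z\<^sub>i\<^sub>-\<^sub>1\<close>, indices being cyclic. Such a cycle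
satisfies \<open>z\<^sub>i = J\<^sub>i \<cdots> J\<^sub>j\<^sub>+\<^sub>1 z\<^sub>j\<close> for all \<open>i, j\<close> (\<open>cyclic_comp_along_cycle\<close>), so it is determined by
any one of its components, and its \<open>i\<close>-th component lies in \<open>F\<^sub>i\<close>. Conversely the orbit of a point
of \<open>F\<^sub>i\<close> closes up to a cycle (\<open>cycle_through\<close>). Therefore \<open>F\<^sub>i\<close> is exactly the set of \<open>i\<close>-th
components of cycles, and every relation among the \<open>F\<^sub>i\<close> is read off from cycles.\<close>

section \<open>Minimisation of strongly convex functions\<close>

text \<open>Here \<open>C\<close> plays the role of the epigraph of a convex lower semicontinuous function \<open>f\<close>, which avoids
extended real values. The point found minimises \<open>f z + |z|\<^sup>2 / 2\<close>, and the conclusion is the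
first-order condition that \<open>- z0\<close> is a subgradient of \<open>f\<close> at \<open>z0\<close>. A minimising
sequence converges because the parallelogram law makes it Cauchy; the infimum is finite by \<open>bound\<close>.\<close>

lemma strongly_convex_minimizer:
  fixes C :: "('h::{real_inner, complete_space} \<times> real) set"
  assumes "closed C" "convex C" "C \<noteq> {}"
    and bound: "\<And>z t. (z, t) \<in> C \<Longrightarrow> l \<le> t + (norm z)\<^sup>2 / 2"
  obtains z0 t0 where "(z0, t0) \<in> C"
    and "\<And>z t. (z, t) \<in> C \<Longrightarrow> t0 \<le> t + z0 \<bullet> (z - z0)"
proof -
  define \<phi> :: "'h \<times> real \<Rightarrow> real" where "\<phi> = (\<lambda>p. snd p + (norm (fst p))\<^sup>2 / 2)"
  define \<mu> where "\<mu> = Inf (\<phi> ` C)"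
  have bdd: "bdd_below (\<phi> ` C)"
    using bound by (intro bdd_belowI[of _ l]) (auto simp: \<phi>_def)
  have mu_le: "\<mu> \<le> \<phi> p" if "p \<in> C" for p
    unfolding \<mu>_def using bdd that by (auto intro: cInf_lower)
  have "\<exists>p\<in>C. \<phi> p < \<mu> + inverse (real (Suc n))" for n
  proof -
    have "Inf (\<phi> ` C) < \<mu> + inverse (real (Suc n))" by (simp add: \<mu>_def)
    then show ?thesis using \<open>C \<noteq> {}\<close> bdd by (subst (asm) cInf_less_iff) auto
  qed
  then obtain p where pC: "\<And>n. p n \<in> C" and p_lt: "\<And>n. \<phi> (p n) < \<mu> + inverse (real (Suc n))"
    by metis
  \<comment> \<open>Comparing the infimum with the value at the midpoint of two points of \<open>C\<close> bounds the
    distance of their first components by how far the two values exceed the infimum.\<close>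
  have gap: "(norm (fst q - fst r))\<^sup>2 \<le> 4 * ((\<phi> q - \<mu>) + (\<phi> r - \<mu>))" if "q \<in> C" "r \<in> C" for q r
  proof -
    have "(1/2) *\<^sub>R q + (1/2) *\<^sub>R r \<in> C"
      using \<open>convex C\<close> that by (intro convexD) auto
    from mu_le[OF this]
    have "\<mu> \<le> snd q / 2 + snd r / 2 + (norm ((1/2) *\<^sub>R fst q + (1/2) *\<^sub>R fst r))\<^sup>2 / 2"
      by (simp add: \<phi>_def)
    also have "(norm ((1/2) *\<^sub>R fst q + (1/2) *\<^sub>R fst r))\<^sup>2
        = ((norm (fst q))\<^sup>2 + (norm (fst r))\<^sup>2) / 2 - (norm (fst q - fst r))\<^sup>2 / 4"
      by (simp add: power2_norm_eq_inner inner_add_left inner_add_right inner_diff_left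
        inner_diff_right inner_commute field_simps)
    finally show ?thesis by (simp add: \<phi>_def field_simps)
  qed
  have "Cauchy (\<lambda>n. fst (p n))"
  proof (rule metric_CauchyI)
    fix \<epsilon> :: real assume "0 < \<epsilon>"
    then obtain N where N: "inverse (real (Suc N)) < \<epsilon>\<^sup>2 / 8"
      using reals_Archimedean[of "\<epsilon>\<^sup>2 / 8"] by auto
    have small: "\<phi> (p n) - \<mu> < \<epsilon>\<^sup>2 / 8" if "n \<ge> N" for n
    proof -
      have "inverse (real (Suc n)) \<le> inverse (real (Suc N))"
        using that by (intro le_imp_inverse_le) auto
      then show ?thesis using p_lt[of n] N by linarith
    qed
    have "dist (fst (p m)) (fst (p n)) < \<epsilon>" if "m \<ge> N" "n \<ge> N" for m n
    proof -
      have "(norm (fst (p m) - fst (p n)))\<^sup>2 < \<epsilon>\<^sup>2"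
        using gap[OF pC pC, of m n] small[OF that(1)] small[OF that(2)] by argo
      then show ?thesis using \<open>0 < \<epsilon>\<close> by (auto simp: dist_norm intro: power2_less_imp_less)
    qed
    then show "\<exists>M. \<forall>m\<ge>M. \<forall>n\<ge>M. dist (fst (p m)) (fst (p n)) < \<epsilon>" by blast
  qed
  then obtain z0 where z0: "(\<lambda>n. fst (p n)) \<longlonglongrightarrow> z0"
    using Cauchy_convergent_iff convergent_def by blast
  have "(\<lambda>n. \<phi> (p n)) \<longlonglongrightarrow> \<mu>"
  proof (rule tendsto_sandwich[where f = "\<lambda>_. \<mu>" and h = "\<lambda>n. \<mu> + inverse (real (Suc n))"])
    show "(\<lambda>n. \<mu> + inverse (real (Suc n))) \<longlonglongrightarrow> \<mu>"
      using tendsto_add[OF tendsto_const LIMSEQ_inverse_real_of_nat, of \<mu>] by simp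
    show "\<forall>\<^sub>F n in sequentially. \<mu> \<le> \<phi> (p n)"
      using mu_le[OF pC] by simp
    show "\<forall>\<^sub>F n in sequentially. \<phi> (p n) \<le> \<mu> + inverse (real (Suc n))"
      using less_imp_le[OF p_lt] by (intro always_eventually) blast
  qed simp
  then have "(\<lambda>n. \<phi> (p n) - (norm (fst (p n)))\<^sup>2 / 2) \<longlonglongrightarrow> \<mu> - (norm z0)\<^sup>2 / 2"
    by (intro tendsto_intros z0) simp_all
  then have "(\<lambda>n. snd (p n)) \<longlonglongrightarrow> \<mu> - (norm z0)\<^sup>2 / 2"
    by (simp add: \<phi>_def)
  then have "(\<lambda>n. p n) \<longlonglongrightarrow> (z0, \<mu> - (norm z0)\<^sup>2 / 2)"
    using tendsto_Pair[OF z0] by fastforce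
  then have min_in: "(z0, \<mu> - (norm z0)\<^sup>2 / 2) \<in> C"
    using \<open>closed C\<close> pC closed_sequentially by blast
  define t0 where "t0 = \<mu> - (norm z0)\<^sup>2 / 2"
  \<comment> \<open>Move from the minimiser towards \<open>(z, t)\<close> by a fraction \<open>s\<close>, divide the increase by \<open>s\<close>, and
    let \<open>s\<close> tend to zero.\<close>
  have "t0 \<le> t + z0 \<bullet> (z - z0)" if zt: "(z, t) \<in> C" for z t
  proof -
    have "0 \<le> (t - t0 + z0 \<bullet> (z - z0)) + s * ((norm (z - z0))\<^sup>2 / 2)" if s: "0 < s" "s \<le> 1" for s
    proof -
      have "(1 - s) *\<^sub>R (z0, t0) + s *\<^sub>R (z, t) \<in> C"
        using \<open>convex C\<close> min_in zt s by (intro convexD) (auto simp: t0_def)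
      from mu_le[OF this]
      have "\<mu> \<le> (1 - s) * t0 + s * t + (norm (z0 + s *\<^sub>R (z - z0)))\<^sup>2 / 2"
        by (simp add: \<phi>_def algebra_simps)
      also have "(norm (z0 + s *\<^sub>R (z - z0)))\<^sup>2
          = (norm z0)\<^sup>2 + 2 * (s * (z0 \<bullet> (z - z0))) + s * (s * (norm (z - z0))\<^sup>2)"
        unfolding power2_norm_eq_inner inner_add_left inner_add_right
          inner_scaleR_left inner_scaleR_right
        by (simp add: inner_commute distrib_left)
      finally have "t0 + (norm z0)\<^sup>2 / 2 \<le> (1 - s) * t0 + s * t
          + ((norm z0)\<^sup>2 + 2 * (s * (z0 \<bullet> (z - z0))) + s * (s * (norm (z - z0))\<^sup>2)) / 2"
        by (simp add: t0_def)
      then have "0 \<le> s * t - s * t0 + s * (z0 \<bullet> (z - z0)) + s * (s * (norm (z - z0))\<^sup>2) / 2"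
        by (simp add: left_diff_distrib add_divide_distrib)
      then have "0 \<le> s * ((t - t0 + z0 \<bullet> (z - z0)) + s * ((norm (z - z0))\<^sup>2 / 2))"
        by (simp add: distrib_left right_diff_distrib)
      then show ?thesis using \<open>0 < s\<close> by (simp add: zero_le_mult_iff)
    qed
    then have "\<forall>\<^sub>F s in at_right 0.
        0 \<le> (t - t0 + z0 \<bullet> (z - z0)) + s * ((norm (z - z0))\<^sup>2 / 2)"
      unfolding eventually_at_right_field by (intro exI[of _ 1]) auto
    moreover have "((\<lambda>s. (t - t0 + z0 \<bullet> (z - z0)) + s * ((norm (z - z0))\<^sup>2 / 2))
        \<longlongrightarrow> (t - t0 + z0 \<bullet> (z - z0)) + 0 * ((norm (z - z0))\<^sup>2 / 2)) (at_right 0)"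
      by (intro tendsto_intros)
    ultimately have "0 \<le> t - t0 + z0 \<bullet> (z - z0)"
      using tendsto_lowerbound[of _ _ "at_right (0::real)"] by fastforce
    then show ?thesis by simp
  qed
  then show thesis using that min_in by (auto simp: t0_def)
qed

section \<open>Surjectivity of the identity plus a maximally monotone operator\<close>

text \<open>Otherwise adding the pair \<open>(x, u)\<close> to the graph of \<open>A\<close> would give a proper monotone extension.\<close>

lemma maximally_monotone_memI:
  assumes "maximally_monotone A" and "\<And>a b. b \<in> A a \<Longrightarrow> 0 \<le> (x - a) \<bullet> (u - b)"
  shows "u \<in> A x"
proof -
  define B where "B = A(x := insert u (A x))"
  have flip: "0 \<le> (a - x) \<bullet> (b - u)" if "b \<in> A a" for a b
    using assms(2)[OF that] by (simp add: inner_diff_left inner_diff_right)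
  have "monotone_operator B"
    using assms flip unfolding maximally_monotone_def monotone_operator_def B_def
    by (auto split: if_splits)
  moreover have "\<forall>y. A y \<subseteq> B y" by (auto simp: B_def)
  ultimately have "B = A" using assms(1) by (simp add: maximally_monotone_def)
  then show ?thesis by (metis B_def fun_upd_same insertI1)
qed

lemma maximally_monotone_iff:
  "maximally_monotone A \<longleftrightarrow> monotone_operator A \<and>
    (\<forall>x u. (\<forall>a. \<forall>b\<in>A a. 0 \<le> (x - a) \<bullet> (u - b)) \<longrightarrow> u \<in> A x)" (is "?L \<longleftrightarrow> ?R")
proof
  assume ?L
  then show ?R using maximally_monotone_memI unfolding maximally_monotone_def by blast
next
  assume R: ?R
  have "B = A" if B: "monotone_operator B" "\<forall>x. A x \<subseteq> B x" for B
  proof (intro ext equalityI subsetI)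
    fix x u assume "u \<in> B x"
    then have "\<forall>a. \<forall>b\<in>A a. 0 \<le> (x - a) \<bullet> (u - b)"
      using B unfolding monotone_operator_def by blast
    then show "u \<in> A x" using R by blast
  qed (use B in auto)
  then show ?L using R by (simp add: maximally_monotone_def)
qed

lemma maximally_monotone_shift:
  assumes "maximally_monotone A"
  shows "maximally_monotone (\<lambda>x. (\<lambda>u. u - y) ` A x)"
  unfolding maximally_monotone_iff
proof (intro conjI allI impI)
  show "monotone_operator (\<lambda>x. (\<lambda>u. u - y) ` A x)"
    using assms by (auto simp: maximally_monotone_def monotone_operator_def)
next
  fix x u assume "\<forall>a. \<forall>b\<in>(\<lambda>u. u - y) ` A a. 0 \<le> (x - a) \<bullet> (u - b)"
  then have "u + y \<in> A x"
    by (intro maximally_monotone_memI[OF assms]) (auto simp: algebra_simps)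
  then show "u \<in> (\<lambda>u. u - y) ` A x" by force
qed

text \<open>The set \<open>C\<close> below is the epigraph of the Fitzpatrick function of \<open>A\<close>, an intersection of closed half
spaces. It lies above the duality product: if \<open>u \<in> A x\<close>, use the half space of the pair \<open>(x, u)\<close>
itself, and otherwise one of a pair that is not monotonically related to \<open>(x, u)\<close>.\<close>

lemma maximally_monotone_zero_in_Id_plus:
  fixes A :: "'a::{real_inner, complete_space} operator"
  assumes A: "maximally_monotone A"
  shows "\<exists>x. - x \<in> A x"
proof -
  define C :: "(('a \<times> 'a) \<times> real) set" where
    "C = {p. \<forall>a b. b \<in> A a \<longrightarrow> fst (fst p) \<bullet> b + a \<bullet> snd (fst p) - a \<bullet> b \<le> snd p}"
  have mono: "0 \<le> (a - a') \<bullet> (b - b')" if "b \<in> A a" "b' \<in> A a'" for a a' b b'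
    using A that by (auto simp: maximally_monotone_def monotone_operator_def)
  have C_eq: "C = (\<Inter>a. \<Inter>b\<in>A a. {p. fst (fst p) \<bullet> b + a \<bullet> snd (fst p) - a \<bullet> b \<le> snd p})"
    by (auto simp: C_def)
  have "closed C"
    unfolding C_eq by (intro closed_INT ballI closed_Collect_le continuous_intros)
  moreover have "convex C"
    unfolding C_eq
  proof (intro convex_INT convexI)
    fix a b :: 'a and p q :: "('a \<times> 'a) \<times> real" and s t :: real
    assume st: "0 \<le> s" "0 \<le> t" "s + t = 1"
      and p: "p \<in> {p. fst (fst p) \<bullet> b + a \<bullet> snd (fst p) - a \<bullet> b \<le> snd p}"
      and q: "q \<in> {p. fst (fst p) \<bullet> b + a \<bullet> snd (fst p) - a \<bullet> b \<le> snd p}"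
    have "s * (fst (fst p) \<bullet> b + a \<bullet> snd (fst p) - a \<bullet> b)
        + t * (fst (fst q) \<bullet> b + a \<bullet> snd (fst q) - a \<bullet> b) \<le> s * snd p + t * snd q"
      using st p q by (intro add_mono mult_left_mono) auto
    moreover have "s * (a \<bullet> b) + t * (a \<bullet> b) = a \<bullet> b"
      using st(3) by (metis distrib_right mult_1)
    ultimately show "s *\<^sub>R p + t *\<^sub>R q \<in> {p. fst (fst p) \<bullet> b + a \<bullet> snd (fst p) - a \<bullet> b \<le> snd p}"
      by (simp add: inner_add_left inner_add_right algebra_simps)
  qed
  moreover have graph: "((a, b), a \<bullet> b) \<in> C" if "b \<in> A a" for a b
    using mono[OF that] by (auto simp: C_def algebra_simps)
  have "\<exists>a b. b \<in> A a"
    using maximally_monotone_memI[OF A, of 0 0] by auto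
  then have "C \<noteq> {}" using graph by blast
  moreover have duality: "x \<bullet> u \<le> t" if "((x, u), t) \<in> C" for x u t
  proof (cases "u \<in> A x")
    case True
    then show ?thesis using that by (force simp: C_def)
  next
    case False
    then obtain a b where ab: "b \<in> A a" "(x - a) \<bullet> (u - b) < 0"
      using maximally_monotone_memI[OF A, of x u] by (meson not_le)
    then have "x \<bullet> b + a \<bullet> u - a \<bullet> b \<le> t" using that by (auto simp: C_def)
    then show ?thesis using ab(2) by (simp add: algebra_simps)
  qed
  moreover have "0 \<le> t + (norm z)\<^sup>2 / 2" if "(z, t) \<in> C" for z t
  proof (cases z)
    case (Pair x u)
    have "0 \<le> (x + u) \<bullet> (x + u)" by simp
    also have "(x + u) \<bullet> (x + u) = 2 * (x \<bullet> u) + (norm z)\<^sup>2"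
      by (simp add: Pair power2_norm_eq_inner inner_add_left inner_add_right inner_commute)
    finally show ?thesis using duality[of x u t] that Pair by simp
  qed
  ultimately obtain z0 t0 where z0: "(z0, t0) \<in> C"
    and opt: "\<And>z t. (z, t) \<in> C \<Longrightarrow> t0 \<le> t + z0 \<bullet> (z - z0)"
    using strongly_convex_minimizer[of C 0] by blast
  obtain x u where xu: "z0 = (x, u)" by fastforce
  \<comment> \<open>This is the first-order condition on the graph of \<open>A\<close>, where the Fitzpatrick function is the
    duality product, with \<open>x \<bullet> u \<le> t0\<close> inserted.\<close>
  have key: "(x + u) \<bullet> (x + u) \<le> (- u - a) \<bullet> (- x - b)" if "b \<in> A a" for a b
    using opt[OF graph[OF that]] duality[of x u t0] z0 xu
    by (simp add: inner_add_left inner_add_right inner_diff_left inner_diff_right inner_commute)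
  then have "- x \<in> A (- u)"
    by (intro maximally_monotone_memI[OF A]) (meson inner_ge_zero order_trans)
  from key[OF this] have "(x + u) \<bullet> (x + u) \<le> 0" by simp
  then have "(x + u) \<bullet> (x + u) = 0" using inner_ge_zero[of "x + u"] by linarith
  then have "u = - x" by (simp only: inner_eq_zero_iff add_eq_0_iff)
  then show ?thesis using \<open>- x \<in> A (- u)\<close> by auto
qed

theorem Minty:
  fixes A :: "'a::{real_inner, complete_space} operator"
  assumes "maximally_monotone A"
  shows "\<exists>x. y - x \<in> A x"
proof -
  obtain x where "- x \<in> (\<lambda>u. u - y) ` A x"
    using maximally_monotone_zero_in_Id_plus[OF maximally_monotone_shift[OF assms]] by blast
  then obtain u where "u \<in> A x" "- x = u - y" by blast
  moreover from this have "u = y - x" by (simp add: algebra_simps)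
  ultimately have "y - x \<in> A x" by simp
  then show ?thesis by blast
qed

section \<open>Resolvents\<close>

lemma mem_inverse_Id_plus_iff:
  "x \<in> inverse_operator (Id_plus A) y \<longleftrightarrow> y - x \<in> A x"
  by (auto simp: inverse_operator_def Id_plus_def) (metis diff_add_cancel add.commute)

lemma resolvent_unique:
  assumes "monotone_operator A" "y - x \<in> A x" "y - x' \<in> A x'"
  shows "x' = x"
proof -
  have "0 \<le> (x - x') \<bullet> ((y - x) - (y - x'))"
    using assms unfolding monotone_operator_def by blast
  moreover have "(x - x') \<bullet> ((y - x) - (y - x')) = - ((x - x') \<bullet> (x - x'))"
    by (simp add: algebra_simps)
  ultimately have "(x - x') \<bullet> (x - x') = 0" using inner_ge_zero[of "x - x'"] by linarith
  then show ?thesis by simp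
qed

lemma resolvent_eq_iff:
  fixes A :: "'a::{real_inner, complete_space} operator"
  assumes "maximally_monotone A"
  shows "resolvent A y = x \<longleftrightarrow> y - x \<in> A x"
proof -
  have mono: "monotone_operator A" using assms by (simp add: maximally_monotone_def)
  obtain x0 where x0: "y - x0 \<in> A x0" using Minty[OF assms] by blast
  then have "resolvent A y = x0"
    unfolding resolvent_def mem_inverse_Id_plus_iff
    by (intro the_equality) (auto dest: resolvent_unique[OF mono])
  then show ?thesis using x0 resolvent_unique[OF mono] by blast
qed

text \<open>Monotonicity gives firm nonexpansiveness,
\<open>|J y - J y'|\<^sup>2 \<le> (J y - J y') \<bullet> (y - y')\<close>, and the Cauchy--Schwarz inequality does the rest.\<close>

lemma resolvent_nonexpansive:
  fixes A :: "'a::{real_inner, complete_space} operator"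
  assumes "maximally_monotone A"
  shows "1-lipschitz_on UNIV (resolvent A)"
proof (rule lipschitz_onI)
  fix y y' :: 'a
  define p q where "p = resolvent A y" and "q = resolvent A y'"
  have "y - p \<in> A p" "y' - q \<in> A q"
    unfolding p_def q_def using resolvent_eq_iff[OF assms] by blast+
  then have "0 \<le> (p - q) \<bullet> ((y - p) - (y' - q))"
    using assms unfolding maximally_monotone_def monotone_operator_def by blast
  then have "(norm (p - q))\<^sup>2 \<le> (p - q) \<bullet> (y - y')"
    by (simp add: power2_norm_eq_inner algebra_simps)
  also have "\<dots> \<le> norm (p - q) * norm (y - y')" by (rule norm_cauchy_schwarz)
  finally have "norm (p - q) \<le> norm (y - y')"
    by (cases "norm (p - q) = 0") (auto simp: power2_eq_square)
  then show "dist (resolvent A y) (resolvent A y') \<le> 1 * dist y y'"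
    by (simp add: p_def q_def dist_norm)
qed simp

section \<open>Fixed points of nonexpansive mappings\<close>

lemma closed_Fix_nonexpansive:
  fixes T :: "'a::metric_space \<Rightarrow> 'a"
  assumes "1-lipschitz_on UNIV T"
  shows "closed (Fix T)"
  unfolding Fix_def
  using lipschitz_on_continuous_on[OF assms] by (intro closed_Collect_eq continuous_on_id)

text \<open>For \<open>z\<close> on the segment between fixed points \<open>x\<close> and \<open>y\<close>, the image \<open>T z\<close> is at most as far from \<open>x\<close>
and from \<open>y\<close> as \<open>z\<close> is. Stewart's identity shows that \<open>z\<close> is the only point with this property.\<close>

lemma convex_Fix_nonexpansive:
  fixes T :: "'a::real_inner \<Rightarrow> 'a"
  assumes T: "1-lipschitz_on UNIV T"
  shows "convex (Fix T)"
proof (rule convexI)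
  fix x y :: 'a and s t :: real
  assume x: "x \<in> Fix T" and y: "y \<in> Fix T" and st: "0 \<le> s" "0 \<le> t" "s + t = 1"
  define z where "z = s *\<^sub>R x + t *\<^sub>R y"
  have s: "s = 1 - t" using st by simp
  have stewart: "s * (norm (w - x))\<^sup>2 + t * (norm (w - y))\<^sup>2
      = (norm (w - z))\<^sup>2 + s * t * (norm (x - y))\<^sup>2" for w
    unfolding z_def s power2_norm_eq_inner
    by (simp add: inner_add_left inner_add_right inner_diff_left inner_diff_right
      inner_commute algebra_simps)
  have le: "(norm (T z - v))\<^sup>2 \<le> (norm (z - v))\<^sup>2" if "v \<in> Fix T" for v
    using lipschitz_onD[OF T, of z v] that by (auto simp: Fix_def dist_norm power_mono)
  have "(norm (T z - z))\<^sup>2 + s * t * (norm (x - y))\<^sup>2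
      \<le> (norm (z - z))\<^sup>2 + s * t * (norm (x - y))\<^sup>2"
    unfolding stewart[symmetric] using st le[OF x] le[OF y]
    by (intro add_mono mult_left_mono)
  then have "T z = z" by simp
  then show "s *\<^sub>R x + t *\<^sub>R y \<in> Fix T" by (simp add: Fix_def z_def)
qed

lemma fold_nonexpansive:
  assumes "\<And>i. i \<in> set is \<Longrightarrow> 1-lipschitz_on UNIV (J i)"
  shows "1-lipschitz_on UNIV (fold J is)"
  using assms
proof (induction "is")
  case Nil
  show ?case by (auto intro: lipschitz_onI)
next
  case (Cons i "is")
  have "1-lipschitz_on UNIV (J i)" using Cons.prems by simp
  moreover have "1-lipschitz_on (J i ` UNIV) (fold J is)"
    using Cons by (auto intro: lipschitz_on_subset)
  ultimately have "(1 * 1)-lipschitz_on UNIV (fold J is \<circ> J i)"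
    by (rule lipschitz_on_compose)
  then show ?case by simp
qed

section \<open>Cycles\<close>

definition cyclic_pred :: "nat \<Rightarrow> nat \<Rightarrow> nat" where
  "cyclic_pred m i = (if i = 1 then m else i - 1)"

definition is_cycle :: "nat \<Rightarrow> (nat \<Rightarrow> 'a \<Rightarrow> 'a) \<Rightarrow> (nat \<Rightarrow> 'a) \<Rightarrow> bool" where
  "is_cycle m J z \<longleftrightarrow> (\<forall>i\<in>{1..m}. z i = J i (z (cyclic_pred m i)))"

lemma cyclic_pred_in: "i \<in> {1..m} \<Longrightarrow> cyclic_pred m i \<in> {1..m}"
  by (auto simp: cyclic_pred_def)

lemma bij_betw_cyclic_pred: "bij_betw (cyclic_pred m) {1..m} {1..m}"
  by (rule bij_betw_byWitness[where f' = "\<lambda>i. if i = m then 1 else i + 1"])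
    (auto simp: cyclic_pred_def)

lemma set_cyclic_indices:
  "\<lbrakk>i \<in> {1..m}; j \<in> {1..m}\<rbrakk> \<Longrightarrow> set (cyclic_indices m j i) \<subseteq> {1..m}"
  by (auto simp: cyclic_indices_def)

lemma fold_along_cycle:
  assumes z: "is_cycle m J z" and "1 \<le> a" "a \<le> b" "b \<le> m"
  shows "fold J [a+1..<b+1] (z a) = z b"
  using \<open>a \<le> b\<close> \<open>b \<le> m\<close>
proof (induction b rule: dec_induct)
  case (step n)
  have "z (Suc n) = J (Suc n) (z n)"
    using z step \<open>1 \<le> a\<close> by (auto simp: is_cycle_def cyclic_pred_def)
  with step show ?case by simp
qed simp

text \<open>Applying the mappings in cyclic order to one component walks along the cycle; if the index passes
from \<open>m\<close> to \<open>1\<close>, the walk is split there. The case \<open>i = j\<close> is a full turn, which puts \<open>z i\<close> into the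
\<open>i\<close>-th fixed point set.\<close>

lemma cyclic_comp_along_cycle:
  assumes z: "is_cycle m J z" and i: "i \<in> {1..m}" and j: "j \<in> {1..m}"
  shows "cyclic_comp m J j i (z j) = z i"
proof (cases "j < i")
  case True
  then show ?thesis
    using fold_along_cycle[OF z, of j i] i j by (simp add: cyclic_comp_def cyclic_indices_def)
next
  case False
  have to_m: "fold J [j+1..<m+1] (z j) = z m"
    using fold_along_cycle[OF z, of j m] j by simp
  have "z 1 = J 1 (z m)" using z i by (auto simp: is_cycle_def cyclic_pred_def)
  moreover have "[1..<i+1] = 1 # [1+1..<i+1]" using i upt_conv_Cons[of 1 "i+1"] by simp
  ultimately have "fold J [1..<i+1] (z m) = z i"
    using fold_along_cycle[OF z, of 1 i] i by simp
  then show ?thesis using False to_m by (simp add: cyclic_comp_def cyclic_indices_def)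
qed

text \<open>Peels off the last mapping. When the predecessor of \<open>j\<close> is the starting index \<open>i\<close>, nothing is left to
compose, whereas \<open>cyclic_comp m J i i\<close> would stand for a full turn.\<close>

lemma cyclic_comp_step:
  assumes "i \<in> {1..m}" "j \<in> {1..m}"
  shows "cyclic_comp m J i j x =
    J j (if cyclic_pred m j = i then x else cyclic_comp m J i (cyclic_pred m j) x)"
proof -
  have "cyclic_indices m i j =
      (if cyclic_pred m j = i then [] else cyclic_indices m i (cyclic_pred m j)) @ [j]"
    using assms upt_Suc_append[of "i+1" j] upt_Suc_append[of 1 j]
    by (cases j) (auto simp: cyclic_indices_def cyclic_pred_def)
  then show ?thesis by (simp add: cyclic_comp_def)
qed

text \<open>The orbit of \<open>x\<close> under the mappings taken in cyclic order from index \<open>i\<close> closes up because \<open>x\<close> is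
fixed by a full turn. For the same reason the full turn gives the right component at \<open>j = i\<close>.\<close>

lemma cycle_through:
  assumes i: "i \<in> {1..m}" and x: "x \<in> cyclic_Fix m J i"
  shows "is_cycle m J (\<lambda>j. cyclic_comp m J i j x)" "cyclic_comp m J i i x = x"
proof -
  show fix_x: "cyclic_comp m J i i x = x" using x by (simp add: cyclic_Fix_def Fix_def)
  show "is_cycle m J (\<lambda>j. cyclic_comp m J i j x)"
    unfolding is_cycle_def
  proof
    fix j assume "j \<in> {1..m}"
    from cyclic_comp_step[OF i this, of J x] fix_x
    show "cyclic_comp m J i j x = J j (cyclic_comp m J i (cyclic_pred m j) x)"
      by (auto split: if_splits)
  qed
qed

text \<open>With this description, a relation between two of the fixed point sets reduces to the corresponding
relation between two components of one cycle.\<close>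

lemma cyclic_Fix_eq_cycle_components:
  assumes i: "i \<in> {1..m}"
  shows "cyclic_Fix m J i = (\<lambda>z. z i) ` {z. is_cycle m J z}"
proof (intro equalityI subsetI)
  fix x assume "x \<in> cyclic_Fix m J i"
  from cycle_through[OF i this] show "x \<in> (\<lambda>z. z i) ` {z. is_cycle m J z}"
    by (intro image_eqI[where x = "\<lambda>j. cyclic_comp m J i j x"]) simp_all
next
  fix x assume "x \<in> (\<lambda>z. z i) ` {z. is_cycle m J z}"
  then show "x \<in> cyclic_Fix m J i"
    using cyclic_comp_along_cycle[OF _ i i, of J] by (auto simp: cyclic_Fix_def Fix_def)
qed

lemma cyclic_comp_image_cyclic_Fix:
  assumes i: "i \<in> {1..m}" and j: "j \<in> {1..m}"
  shows "cyclic_comp m J j i ` cyclic_Fix m J j = cyclic_Fix m J i"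
  unfolding cyclic_Fix_eq_cycle_components[OF i] cyclic_Fix_eq_cycle_components[OF j] image_image
  using cyclic_comp_along_cycle[OF _ i j, of J] by (intro image_cong) simp_all

lemma image_cyclic_Fix_pred:
  assumes i: "i \<in> {1..m}"
  shows "J i ` cyclic_Fix m J (cyclic_pred m i) = cyclic_Fix m J i"
  unfolding cyclic_Fix_eq_cycle_components[OF i]
    cyclic_Fix_eq_cycle_components[OF cyclic_pred_in[OF i]] image_image
  using i by (intro image_cong) (simp_all add: is_cycle_def)

lemma common_Fix_subset_cyclic_Fix:
  assumes i: "i \<in> {1..m}"
  shows "(\<Inter>k\<in>{1..m}. Fix (J k)) \<subseteq> cyclic_Fix m J i"
proof
  fix x assume "x \<in> (\<Inter>k\<in>{1..m}. Fix (J k))"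
  then have "is_cycle m J (\<lambda>_. x)" by (auto simp: is_cycle_def Fix_def)
  then show "x \<in> cyclic_Fix m J i" unfolding cyclic_Fix_eq_cycle_components[OF i] by (intro image_eqI) simp_all
qed

section \<open>The product space\<close>

lemma component_tuple:
  assumes "bij_betw e {1..m} UNIV" "i \<in> {1..m}"
  shows "component e i (tuple m e f) = f i"
  using assms by (simp add: component_def tuple_def bij_betw_def the_inv_into_f_f)

lemma component_ext:
  assumes "bij_betw e {1..m} UNIV" "\<And>i. i \<in> {1..m} \<Longrightarrow> component e i x = component e i y"
  shows "x = y"
proof -
  have "x $ k = y $ k" for k
  proof -
    obtain i where "i \<in> {1..m}" "e i = k" using assms(1) by (metis UNIV_I bij_betw_iff_bijections)
    then show ?thesis using assms(2)[of i] by (auto simp: component_def)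
  qed
  then show ?thesis by (simp add: vec_eq_iff)
qed

lemma component_right_shift:
  assumes "bij_betw e {1..m} UNIV" "i \<in> {1..m}"
  shows "component e i (right_shift m e x) = component e (cyclic_pred m i) x"
  by (simp add: right_shift_def component_tuple[OF assms] cyclic_pred_def)

text \<open>The inclusion defining the product resolvent splits into the inclusions defining the factors, which
are uniquely solvable; so the definite description on the product space picks the tuple of the
solutions.\<close>

lemma component_resolvent_product:
  fixes A :: "nat \<Rightarrow> 'a::{real_inner, complete_space} operator"
    and e :: "nat \<Rightarrow> 'n::finite"
  assumes e: "bij_betw e {1..m} UNIV"
    and A: "\<And>i. i \<in> {1..m} \<Longrightarrow> maximally_monotone (A i)"
    and i: "i \<in> {1..m}"
  shows "component e i (resolvent (product_operator m e A) y) = resolvent (A i) (component e i y)"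
proof -
  define x where "x = tuple m e (\<lambda>i. resolvent (A i) (component e i y))"
  have mem: "w \<in> inverse_operator (Id_plus (product_operator m e A)) y
      \<longleftrightarrow> (\<forall>i\<in>{1..m}. resolvent (A i) (component e i y) = component e i w)" for w
    unfolding mem_inverse_Id_plus_iff product_operator_def product_set_def
    using A by (auto simp: resolvent_eq_iff component_def)
  have "resolvent (product_operator m e A) y = x"
    unfolding resolvent_def[of "product_operator m e A"] mem
    by (intro the_equality component_ext[OF e]) (auto simp: x_def component_tuple[OF e])
  then show ?thesis by (simp add: x_def component_tuple[OF e i])
qed

lemma dist_component:
  fixes x y :: "'a::metric_space ^ 'n"
  assumes e: "bij_betw e {1..m} (UNIV :: 'n::finite set)"
  shows "dist x y = L2_set (\<lambda>i. dist (component e i x) (component e i y)) {1..m}"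
  unfolding dist_vec_def L2_set_def component_def
  using sum.reindex_bij_betw[OF e, of "\<lambda>k. (dist (x $ k) (y $ k))\<^sup>2"] by simp

text \<open>The bound holds in each component, and the cyclic shift only permutes the terms of the squared
product norm.\<close>

lemma nonexpansive_on_product_shift:
  fixes S :: "'a::metric_space ^ 'n \<Rightarrow> 'a ^ 'n"
  assumes e: "bij_betw e {1..m} (UNIV :: 'n::finite set)"
    and S: "\<And>i x. i \<in> {1..m} \<Longrightarrow> component e i (S x) = J i (component e (cyclic_pred m i) x)"
    and J: "\<And>i. i \<in> {1..m} \<Longrightarrow> 1-lipschitz_on UNIV (J i)"
  shows "1-lipschitz_on UNIV S"
proof (rule lipschitz_onI)
  fix x y :: "'a ^ 'n"
  have "dist (S x) (S y) \<le> L2_set (\<lambda>i. dist (component e (cyclic_pred m i) x)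
      (component e (cyclic_pred m i) y)) {1..m}"
    unfolding dist_component[OF e]
  proof (rule L2_set_mono)
    fix i assume "i \<in> {1..m}"
    then show "dist (component e i (S x)) (component e i (S y))
        \<le> dist (component e (cyclic_pred m i) x) (component e (cyclic_pred m i) y)"
      using S lipschitz_onD[OF J, of i] by fastforce
  qed simp
  also have "\<dots> = dist x y"
    unfolding dist_component[OF e] L2_set_def
    using sum.reindex_bij_betw[OF bij_betw_cyclic_pred,
      of "\<lambda>i. (dist (component e i x) (component e i y))\<^sup>2" m] by simp
  finally show "dist (S x) (S y) \<le> 1 * dist x y" by simp
qed simp

section \<open>The geometry of the set of cycles\<close>

theorem theorem4p3:
  fixes A :: "nat \<Rightarrow> 'a::{real_inner, complete_space} operator"
    and m :: nat
    and e :: "nat \<Rightarrow> 'n::finite"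
    and J :: "nat \<Rightarrow> 'a \<Rightarrow> 'a"
    and F :: "nat \<Rightarrow> 'a set"
    and JA R :: "'a ^ 'n \<Rightarrow> 'a ^ 'n"
    and Z FF :: "('a ^ 'n) set"
    and Q :: "nat \<Rightarrow> 'a ^ 'n \<Rightarrow> 'a"
  defines "J \<equiv> \<lambda>i. resolvent (A i)"
    and "F \<equiv> cyclic_Fix m J"
    and "JA \<equiv> resolvent (product_operator m e A)"
    and "R \<equiv> right_shift m e"
    and "Z \<equiv> Fix (JA \<circ> R)"
    and "FF \<equiv> product_set m e F"
    and "Q \<equiv> component e"
  assumes "m \<ge> 2"
    and "bij_betw e {1..m} UNIV"
    and "\<And>i. i \<in> {1..m} \<Longrightarrow> maximally_monotone (A i)"
  shows
    "((\<forall>i\<in>{1..m}. closed (F i) \<and> convex (F i)) \<and>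
      (\<forall>i\<in>{1..m}. \<forall>j\<in>{1..m}. j \<noteq> i \<longrightarrow> F i = cyclic_comp m J j i ` F j) \<and>
      (\<forall>j\<in>{1..m-1}. F m = fold J [j+1..<m+1] ` F j) \<and>
      (\<forall>j\<in>{2..m}. F 1 = (J 1 \<circ> fold J [j+1..<m+1]) ` F j)) \<and>
     ((\<Inter>i\<in>{1..m}. Fix (J i)) \<subseteq> (\<Inter>i\<in>{1..m}. F i) \<and>
      (\<forall>i\<in>{1..m}. F i = {} \<longrightarrow> (\<Inter>k\<in>{1..m}. Fix (J k)) = {})) \<and>
     ((\<forall>i\<in>{1..m-1}. J (i+1) ` F i = F (i+1)) \<and>
      J 1 ` F m = F 1 \<and>
      (JA \<circ> R) ` FF = FF) \<and>
     (\<forall>i\<in>{1..m}. \<forall>j\<in>{1..m}. (F i \<noteq> {} \<longleftrightarrow> F j \<noteq> {}) \<and> (F j \<noteq> {} \<longleftrightarrow> Z \<noteq> {})) \<and>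
     (closed Z \<and> convex Z \<and> Z \<subseteq> FF) \<and>
     (\<forall>i\<in>{1..m}. bij_betw (Q i) Z (F i) \<and> Q i ` Z = F i)"
proof -
  note m = \<open>m \<ge> 2\<close> and e = \<open>bij_betw e {1..m} UNIV\<close>
  have J: "1-lipschitz_on UNIV (J i)" if "i \<in> {1..m}" for i
    unfolding J_def using assms(10)[OF that] by (rule resolvent_nonexpansive)
  have comp: "Q i ((JA \<circ> R) x) = J i (Q (cyclic_pred m i) x)" if "i \<in> {1..m}" for i x
    using component_resolvent_product[OF e assms(10) that, where y = "R x"]
      component_right_shift[OF e that, where x = x]
    by (simp add: Q_def JA_def R_def J_def)
  have F_comp: "cyclic_comp m J j i ` F j = F i" if "i \<in> {1..m}" "j \<in> {1..m}" for i j
    unfolding F_def using that by (rule cyclic_comp_image_cyclic_Fix)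
  have F_pred: "J i ` F (cyclic_pred m i) = F i" if "i \<in> {1..m}" for i
    unfolding F_def using that by (rule image_cyclic_Fix_pred)
  have S: "1-lipschitz_on UNIV (JA \<circ> R)"
    using comp J unfolding Q_def by (rule nonexpansive_on_product_shift[OF e])
  have Z_iff: "z \<in> Z \<longleftrightarrow> is_cycle m J (\<lambda>i. Q i z)" for z
  proof
    assume "z \<in> Z"
    then have "z = (JA \<circ> R) z" by (simp add: Z_def Fix_def)
    then show "is_cycle m J (\<lambda>i. Q i z)" using comp unfolding is_cycle_def by metis
  next
    assume "is_cycle m J (\<lambda>i. Q i z)"
    then have "z = (JA \<circ> R) z"
      using comp by (intro component_ext[OF e]) (simp add: is_cycle_def Q_def)
    then show "z \<in> Z" by (simp add: Z_def Fix_def)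
  qed
  \<comment> \<open>\<open>Q i\<close> maps \<open>Z\<close> onto \<open>F i\<close> because \<open>F i\<close> consists of the \<open>i\<close>-th components of cycles.\<close>
  have Q_image: "Q i ` Z = F i" if i: "i \<in> {1..m}" for i
  proof (intro equalityI subsetI)
    fix x assume "x \<in> Q i ` Z"
    then obtain z where "x = Q i z" "is_cycle m J (\<lambda>j. Q j z)"
      using Z_iff by blast
    then show "x \<in> F i"
      unfolding F_def cyclic_Fix_eq_cycle_components[OF i]
      by (intro image_eqI[where x = "\<lambda>j. Q j z"]) simp_all
  next
    fix x assume "x \<in> F i"
    then obtain z where z: "is_cycle m J z" "z i = x"
      unfolding F_def cyclic_Fix_eq_cycle_components[OF i] by blast
    have Q_tuple: "Q j (tuple m e z) = z j" if "j \<in> {1..m}" for j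
      unfolding Q_def using component_tuple[OF e that] .
    have "is_cycle m J (\<lambda>j. Q j (tuple m e z))"
      unfolding is_cycle_def
    proof
      fix j assume j: "j \<in> {1..m}"
      show "Q j (tuple m e z) = J j (Q (cyclic_pred m j) (tuple m e z))"
        unfolding Q_tuple[OF j] Q_tuple[OF cyclic_pred_in[OF j]]
        using z(1) j unfolding is_cycle_def by blast
    qed
    then have "tuple m e z \<in> Z" unfolding Z_iff .
    then show "x \<in> Q i ` Z" using Q_tuple[OF i] z(2) by (intro image_eqI) simp_all
  qed
  have Q_inj: "inj_on (Q i) Z" if i: "i \<in> {1..m}" for i
  proof (rule inj_onI, rule component_ext[OF e])
    fix x y j assume "x \<in> Z" "y \<in> Z" "Q i x = Q i y" and j: "j \<in> {1..m}"
    then show "component e j x = component e j y"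
      using cyclic_comp_along_cycle[OF _ j i, of J] unfolding Z_iff Q_def by metis
  qed
  have p1a: "\<forall>i\<in>{1..m}. closed (F i) \<and> convex (F i)"
  proof
    fix i assume i: "i \<in> {1..m}"
    have "1-lipschitz_on UNIV (cyclic_comp m J i i)"
      unfolding cyclic_comp_def using set_cyclic_indices[OF i i] J
      by (intro fold_nonexpansive) blast
    then show "closed (F i) \<and> convex (F i)"
      unfolding F_def cyclic_Fix_def
      by (simp add: closed_Fix_nonexpansive convex_Fix_nonexpansive)
  qed
  have p1c: "\<forall>j\<in>{1..m-1}. F m = fold J [j+1..<m+1] ` F j"
  proof
    fix j assume "j \<in> {1..m-1}"
    then have j: "j \<in> {1..m}" "j < m" using m by auto
    then have "cyclic_comp m J j m = fold J [j+1..<m+1]"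
      by (simp add: cyclic_comp_def cyclic_indices_def)
    then show "F m = fold J [j+1..<m+1] ` F j"
      using F_comp[of m j] j m by simp
  qed
  have p1d: "\<forall>j\<in>{2..m}. F 1 = (J 1 \<circ> fold J [j+1..<m+1]) ` F j"
  proof
    fix j assume j: "j \<in> {2..m}"
    then have "cyclic_comp m J j 1 = J 1 \<circ> fold J [j+1..<m+1]"
      by (simp add: cyclic_comp_def cyclic_indices_def)
    then show "F 1 = (J 1 \<circ> fold J [j+1..<m+1]) ` F j"
      using F_comp[of 1 j] j by simp
  qed
  have p2: "(\<Inter>k\<in>{1..m}. Fix (J k)) \<subseteq> F i" if "i \<in> {1..m}" for i
    unfolding F_def using that by (rule common_Fix_subset_cyclic_Fix)
  have p3a: "\<forall>i\<in>{1..m-1}. J (i+1) ` F i = F (i+1)"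
  proof
    fix i assume "i \<in> {1..m-1}"
    then have "i + 1 \<in> {1..m}" "cyclic_pred m (i + 1) = i"
      using m by (auto simp: cyclic_pred_def)
    then show "J (i+1) ` F i = F (i+1)"
      using F_pred[of "i + 1"] by simp
  qed
  have p3b: "J 1 ` F m = F 1"
    using F_pred[of 1] m by (simp add: cyclic_pred_def)
  have FF_iff: "x \<in> FF \<longleftrightarrow> (\<forall>i\<in>{1..m}. Q i x \<in> F i)" for x
    by (simp add: FF_def product_set_def Q_def)
  have p3c: "(JA \<circ> R) ` FF = FF"
  proof (intro equalityI subsetI)
    fix y assume "y \<in> (JA \<circ> R) ` FF"
    then obtain x where x: "x \<in> FF" and y: "y = (JA \<circ> R) x" by blast
    show "y \<in> FF"
      unfolding FF_iff
    proof
      fix i assume i: "i \<in> {1..m}"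
      then have "Q (cyclic_pred m i) x \<in> F (cyclic_pred m i)"
        using x cyclic_pred_in FF_iff by blast
      then show "Q i y \<in> F i" unfolding y comp[OF i] using F_pred[OF i] by blast
    qed
  next
    fix y assume "y \<in> FF"
    \<comment> \<open>A preimage of \<open>y\<close> is assembled from preimages under the individual \<open>J i\<close>; the preimage for
      index \<open>i\<close> belongs in position \<open>cyclic_pred m i\<close>.\<close>
    then have "\<forall>i\<in>{1..m}. \<exists>w\<in>F (cyclic_pred m i). J i w = Q i y"
      using F_pred unfolding FF_iff by (metis imageE)
    then obtain w where w: "\<And>i. i \<in> {1..m} \<Longrightarrow> w i \<in> F (cyclic_pred m i) \<and> J i (w i) = Q i y"
      by metis
    define x where "x = tuple m e (\<lambda>k. w (the_inv_into {1..m} (cyclic_pred m) k))"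
    have x: "Q (cyclic_pred m i) x = w i" if "i \<in> {1..m}" for i
      unfolding x_def Q_def component_tuple[OF e cyclic_pred_in[OF that]]
      using bij_betw_cyclic_pred[of m] that by (simp add: bij_betw_def the_inv_into_f_f)
    have "(JA \<circ> R) x = y"
    proof (rule component_ext[OF e])
      fix i assume "i \<in> {1..m}"
      then show "component e i ((JA \<circ> R) x) = component e i y"
        using comp[of i x] x[of i] w[of i] by (simp add: Q_def)
    qed
    moreover have "x \<in> FF"
      unfolding FF_iff
    proof
      fix k assume "k \<in> {1..m}"
      then obtain i where "i \<in> {1..m}" "k = cyclic_pred m i"
        using bij_betw_cyclic_pred[of m] by (metis bij_betw_imp_surj_on imageE)
      then show "Q k x \<in> F k" using x w by auto
    qed
    ultimately show "y \<in> (JA \<circ> R) ` FF" by blast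
  qed
  have p4: "F i \<noteq> {} \<longleftrightarrow> Z \<noteq> {}" if "i \<in> {1..m}" for i
    using Q_image[OF that] by blast
  have "Z \<subseteq> FF" using Q_image unfolding FF_iff subset_iff by blast
  then have p5: "closed Z \<and> convex Z \<and> Z \<subseteq> FF"
    using closed_Fix_nonexpansive[OF S] convex_Fix_nonexpansive[OF S] by (simp add: Z_def)
  show ?thesis
  proof (intro conjI)
    show "\<forall>i\<in>{1..m}. \<forall>j\<in>{1..m}. j \<noteq> i \<longrightarrow> F i = cyclic_comp m J j i ` F j"
      using F_comp by simp
    show "(\<Inter>i\<in>{1..m}. Fix (J i)) \<subseteq> (\<Inter>i\<in>{1..m}. F i)"
      using p2 by (rule INT_greatest)
    show "\<forall>i\<in>{1..m}. F i = {} \<longrightarrow> (\<Inter>k\<in>{1..m}. Fix (J k)) = {}"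
      using p2 by blast
    show "\<forall>i\<in>{1..m}. \<forall>j\<in>{1..m}. (F i \<noteq> {} \<longleftrightarrow> F j \<noteq> {}) \<and> (F j \<noteq> {} \<longleftrightarrow> Z \<noteq> {})"
      using p4 by simp
    show "\<forall>i\<in>{1..m}. bij_betw (Q i) Z (F i) \<and> Q i ` Z = F i"
      using Q_image Q_inj by (simp add: bij_betw_def)
  qed (use p1a p1c p1d p3a p3b p3c p5 in blast)+
qed

end
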